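(* Let $G$ be a graph (with symmetric vertex potential) equipped with a non-trivial involution $\phi$, let $S$ be the set of fixed vertices of $\phi$, and let $G'$ be a half graph induced by $\phi$. Let $M$ be the matrix whose columns are, in this order, the vectors in $\left\{\frac{1}{\sqrt2}(\mathbf{e}_u-\mathbf{e}_{\phi(u)}) : u\in V(G')\right\}$, $\left\{\frac{1}{\sqrt2}(\mathbf{e}_u+\mathbf{e}_{\phi(u)}) : u\in V(G')\right\}$ and $\{\mathbf{e}_u : u\in S\}$. Let $\mathscr{L}$ be the $q$-Laplacian matrix of $G$, with blocks $\mathscr{L}',A_\phi,A_S,\mathscr{L}_S$, and put $$\mathscr{L}_-=\mathscr{L}'-A_\phi,\qquad \widetilde{\mathscr{L}_+}=\begin{bmatrix}\mathscr{L}'+A_\phi & \sqrt2\,A_S\\ \sqrt2\,A_S^T & \mathscr{L}_S\end{bmatrix},\qquad N=\begin{bmatrix}\mathscr{L}_-&\mathbf{0}\\ \mathbf{0}&\widetilde{\mathscr{L}_+}\end{bmatrix}.$$ Then: 1. Strong cospectrality (respectively, perfect state transfer, pretty good state transfer) relative to $N$ occurs between two states $\mathbf{x}$ and $\mathbf{y}$ if and only if strong cospectrality (respectively, perfect state transfer, pretty good state transfer) relative to $\mathscr{L}$ occurs between $M\mathbf{x}$ and $M\mathbf{y}$. 2. Periodicity (respectively, $C$-sedentariness) relative to $N$ occurs from a state $\mathbf{x}$ if and only if periodicity (respectively, $C$-sedentariness) relative to $\mathscr{L}$ occurs from $M\mathbf{x}$.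
   Context: $G$ is a finite undirected graph with positive real edge weights, adjacency matrix $A$ and diagonal degree matrix $\Delta$ (row sums of $A$). An involution $\phi$ of $G$ is an automorphism (preserving edge weights) of order two. The vertices carry a real potential $\eta:V(G)\to\mathbb{R}$ with $\eta(v)=\eta(\phi(v))$ for all $v$, and $\Delta'$ is the diagonal matrix with $\Delta'_{vv}=\eta(v)$. For a non-zero real number $q$, the $q$-Laplacian matrix of $G$ is $\mathscr{L}=(1-q^2)I+q^2(\Delta+\Delta')-qA$. Let $S=\{v:\phi(v)=v\}$. A half graph $G'$ induced by $\phi$ is the induced subgraph on a set $V(G')$ obtained by choosing exactly one vertex from each orbit $\{v,\phi(v)\}$ with $v\notin S$. Order the vertices of $G$ as $V(G')$, then $\phi(V(G'))$ (in the corresponding order), then $S$; then $$\mathscr{L}=\begin{bmatrix}\mathscr{L}' & A_\phi & A_S\\ A_\phi & \mathscr{L}' & A_S\\ A_S^T & A_S^T & \mathscr{L}_S\end{bmatrix},$$ which defines the blocks $\mathscr{L}'$, $A_\phi$, $A_S$, $\mathscr{L}_S$ (degrees and potentials are those in $G$; off-diagonal adjacency entries include the factor $-q$). The columns of $M$ are listed in the corresponding vertex orders, and $\mathbf{e}_u$ is the characteristic vector of vertex $u$. For a real symmetric matrix $B$ with distinct eigenvalues $\theta_j$ and orthogonal eigenprojections $F_j$, let $U_B(t)=\exp(itB)$. A state is a real unit vector. Relative to $B$: perfect state transfer (PST) occurs between $\mathbf{x}$ and $\mathbf{y}$ if $U_B(\tau)\mathbf{x}=\gamma\mathbf{y}$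 for some $\tau>0$ and $\gamma\in\mathbb{C}$; $\mathbf{x}$ is periodic if PST occurs from $\mathbf{x}$ to itself; pretty good state transfer (PGST) occurs between linearly independent $\mathbf{x},\mathbf{y}$ if $\lim_{k\to\infty}U_B(\tau_k)\mathbf{x}=\gamma\mathbf{y}$ for some real sequence $(\tau_k)$ and some $\gamma\in\mathbb{C}$ with $|\gamma|=1$; linearly independent states $\mathbf{x},\mathbf{y}$ are strongly cospectral if for each $j$ with $F_j\mathbf{x}\ne 0$ either $F_j\mathbf{x}=F_j\mathbf{y}$ or $F_j\mathbf{x}=-F_j\mathbf{y}$; for a constant $0<C\le 1$, $\mathbf{x}$ is $C$-sedentary if $\inf_{t>0}|\mathbf{x}^TU_B(t)\mathbf{x}|\ge C$. *)

theory Defs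
  imports Complex_Main "Jordan_Normal_Form.Char_Poly"
begin

section \<open>Weighted graphs with an involution\<close>

text \<open>An edge is the set of its end vertices, so edges are undirected. Loops (singleton
  edges) are permitted; a loop enters the degree once, the degree being a row sum of the
  adjacency matrix.\<close>

locale weighted_graph =
  fixes V :: "'a set" and E :: "'a set set" and wt :: "'a set \<Rightarrow> real"
  assumes finite_V: "finite V"
    and edges: "E \<subseteq> {{u, v} | u v. u \<in> V \<and> v \<in> V}"
    and weight_pos: "e \<in> E \<Longrightarrow> 0 < wt e"

definition adj :: "'a set set \<Rightarrow> ('a set \<Rightarrow> real) \<Rightarrow> 'a \<Rightarrow> 'a \<Rightarrow> real" where
  "adj E wt u v = (if {u, v} \<in> E then wt {u, v} else 0)"

definition automorphism ::
  "'a set \<Rightarrow> 'a set set \<Rightarrow> ('a set \<Rightarrow> real) \<Rightarrow> ('a \<Rightarrow> 'a) \<Rightarrow> bool" where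
  "automorphism V E wt \<phi> \<longleftrightarrow> bij_betw \<phi> V V \<and>
    (\<forall>u\<in>V. \<forall>v\<in>V. {\<phi> u, \<phi> v} \<in> E \<longleftrightarrow> {u, v} \<in> E) \<and>
    (\<forall>u\<in>V. \<forall>v\<in>V. {u, v} \<in> E \<longrightarrow> wt {\<phi> u, \<phi> v} = wt {u, v})"

definition involution ::
  "'a set \<Rightarrow> 'a set set \<Rightarrow> ('a set \<Rightarrow> real) \<Rightarrow> ('a \<Rightarrow> 'a) \<Rightarrow> bool" where
  "involution V E wt \<phi> \<longleftrightarrow> automorphism V E wt \<phi> \<and>
    (\<forall>v\<in>V. \<phi> (\<phi> v) = v) \<and> (\<exists>v\<in>V. \<phi> v \<noteq> v)"

definition fixed_vertices :: "'a set \<Rightarrow> ('a \<Rightarrow> 'a) \<Rightarrow> 'a set" where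
  "fixed_vertices V \<phi> = {v \<in> V. \<phi> v = v}"

text \<open>The vertex set \<open>H\<close> of a half graph; the half graph is the subgraph induced on \<open>H\<close>.\<close>

definition half_graph_vertices :: "'a set \<Rightarrow> ('a \<Rightarrow> 'a) \<Rightarrow> 'a set \<Rightarrow> bool" where
  "half_graph_vertices V \<phi> H \<longleftrightarrow> H \<subseteq> V - fixed_vertices V \<phi> \<and>
    (\<forall>v\<in>V - fixed_vertices V \<phi>. \<exists>!u. u \<in> {v, \<phi> v} \<and> u \<in> H)"


section \<open>The \<open>q\<close>-Laplacian and its blocks\<close>

text \<open>A list \<open>xs\<close> of all vertices without repetition fixes the order of rows and columns.\<close>

definition adj_mat :: "'a set set \<Rightarrow> ('a set \<Rightarrow> real) \<Rightarrow> 'a list \<Rightarrow> real mat" where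
  "adj_mat E wt xs = mat (length xs) (length xs) (\<lambda>(i, j). adj E wt (xs ! i) (xs ! j))"

definition deg_mat :: "'a set set \<Rightarrow> ('a set \<Rightarrow> real) \<Rightarrow> 'a list \<Rightarrow> real mat" where
  "deg_mat E wt xs =
    mat_diag (length xs) (\<lambda>i. \<Sum>j<length xs. adj_mat E wt xs $$ (i, j))"

definition potential_mat :: "('a \<Rightarrow> real) \<Rightarrow> 'a list \<Rightarrow> real mat" where
  "potential_mat \<eta> xs = mat_diag (length xs) (\<lambda>i. \<eta> (xs ! i))"

definition qlaplacian ::
  "'a set set \<Rightarrow> ('a set \<Rightarrow> real) \<Rightarrow> ('a \<Rightarrow> real) \<Rightarrow> real \<Rightarrow> 'a list \<Rightarrow> real mat" where
  "qlaplacian E wt \<eta> q xs =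
    (1 - q\<^sup>2) \<cdot>\<^sub>m 1\<^sub>m (length xs) +
    q\<^sup>2 \<cdot>\<^sub>m (deg_mat E wt xs + potential_mat \<eta> xs) - q \<cdot>\<^sub>m adj_mat E wt xs"

text \<open>Below, \<open>vs\<close> lists the vertices of the half graph and \<open>ss\<close> the fixed vertices.\<close>

definition vertex_order :: "('a \<Rightarrow> 'a) \<Rightarrow> 'a list \<Rightarrow> 'a list \<Rightarrow> 'a list" where
  "vertex_order \<phi> vs ss = vs @ map \<phi> vs @ ss"

definition block :: "'b mat \<Rightarrow> nat \<Rightarrow> nat \<Rightarrow> nat \<Rightarrow> nat \<Rightarrow> 'b mat" where
  "block B r nr c nc = mat nr nc (\<lambda>(i, j). B $$ (r + i, c + j))"

text \<open>Here \<open>L\<close> is a square matrix of size \<open>h + h + s\<close>, partitioned accordingly.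
  The blocks are \<open>L' = block L 0 h 0 h\<close>, \<open>A\<^sub>\<phi> = block L 0 h h h\<close>, \<open>A\<^sub>S = block L 0 h (2 * h) s\<close>
  and \<open>L\<^sub>S = block L (2 * h) s (2 * h) s\<close>.\<close>

definition L_minus :: "nat \<Rightarrow> real mat \<Rightarrow> real mat" where
  "L_minus h L = block L 0 h 0 h - block L 0 h h h"

definition L_plus_tilde :: "nat \<Rightarrow> nat \<Rightarrow> real mat \<Rightarrow> real mat" where
  "L_plus_tilde h s L = four_block_mat
    (block L 0 h 0 h + block L 0 h h h)
    (sqrt 2 \<cdot>\<^sub>m block L 0 h (2 * h) s)
    (sqrt 2 \<cdot>\<^sub>m transpose_mat (block L 0 h (2 * h) s))
    (block L (2 * h) s (2 * h) s)"

definition N_mat :: "nat \<Rightarrow> nat \<Rightarrow> real mat \<Rightarrow> real mat" where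
  "N_mat h s L = four_block_mat
    (L_minus h L) (0\<^sub>m h (h + s)) (0\<^sub>m (h + s) h) (L_plus_tilde h s L)"

definition char_vec :: "'a list \<Rightarrow> 'a \<Rightarrow> real vec" where
  "char_vec xs u = vec (length xs) (\<lambda>i. if xs ! i = u then 1 else 0)"

definition M_mat :: "('a \<Rightarrow> 'a) \<Rightarrow> 'a list \<Rightarrow> 'a list \<Rightarrow> real mat" where
  "M_mat \<phi> vs ss = (let xs = vertex_order \<phi> vs ss in
    mat_of_cols (length xs)
      (map (\<lambda>u. (1 / sqrt 2) \<cdot>\<^sub>v (char_vec xs u - char_vec xs (\<phi> u))) vs @
       map (\<lambda>u. (1 / sqrt 2) \<cdot>\<^sub>v (char_vec xs u + char_vec xs (\<phi> u))) vs @
       map (char_vec xs) ss))"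


section \<open>Eigenprojections\<close>

definition is_orth_projection :: "nat \<Rightarrow> real vec set \<Rightarrow> real mat \<Rightarrow> bool" where
  "is_orth_projection n W F \<longleftrightarrow> F \<in> carrier_mat n n \<and> transpose_mat F = F \<and> F * F = F \<and>
    (\<lambda>v. F *\<^sub>v v) ` carrier_vec n = W"

definition eigenspace :: "real mat \<Rightarrow> real \<Rightarrow> real vec set" where
  "eigenspace B \<theta> = {v \<in> carrier_vec (dim_row B). B *\<^sub>v v = \<theta> \<cdot>\<^sub>v v}"

definition eigenprojection :: "real mat \<Rightarrow> real \<Rightarrow> real mat" where
  "eigenprojection B \<theta> = (THE F. is_orth_projection (dim_row B) (eigenspace B \<theta>) F)"

lemma mat_eq_by_mult_vec:
  assumes A: "A \<in> carrier_mat n n" and B: "B \<in> carrier_mat n n"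
    and eq: "\<And>v. v \<in> carrier_vec n \<Longrightarrow> A *\<^sub>v v = B *\<^sub>v (v :: real vec)"
  shows "A = B"
proof (rule mat_col_eqI)
  fix j assume j: "j < dim_col B"
  have "A *\<^sub>v unit_vec n j = B *\<^sub>v unit_vec n j" by (rule eq) simp
  moreover have "A *\<^sub>v unit_vec n j = col A j" "B *\<^sub>v unit_vec n j = col B j"
    using A B j by (auto intro!: eq_vecI)
  ultimately show "col A j = col B j" by simp
qed (use A B in auto)

lemma is_orth_projection_unique:
  assumes F: "is_orth_projection n W F" and G: "is_orth_projection n W G"
  shows "F = G"
proof -
  have absorb: "A * B = B"
    if A: "is_orth_projection n W A" and B: "is_orth_projection n W B" for A B
  proof (rule mat_eq_by_mult_vec)
    have cA: "A \<in> carrier_mat n n" and cB: "B \<in> carrier_mat n n"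
      using A B by (auto simp: is_orth_projection_def)
    then show "A * B \<in> carrier_mat n n" "B \<in> carrier_mat n n" by auto
    fix v :: "real vec" assume v: "v \<in> carrier_vec n"
    then have "B *\<^sub>v v \<in> (\<lambda>v. A *\<^sub>v v) ` carrier_vec n"
      using A B by (auto simp: is_orth_projection_def)
    then obtain w where w: "w \<in> carrier_vec n" "B *\<^sub>v v = A *\<^sub>v w" by auto
    have "A *\<^sub>v (A *\<^sub>v w) = A *\<^sub>v w"
      using assoc_mult_mat_vec[OF cA cA w(1)] A by (simp add: is_orth_projection_def)
    then show "A * B *\<^sub>v v = B *\<^sub>v v"
      using assoc_mult_mat_vec[OF cA cB v] w by simp
  qed
  have c: "F \<in> carrier_mat n n" "G \<in> carrier_mat n n"
    and t: "transpose_mat F = F" "transpose_mat G = G"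
    using F G by (auto simp: is_orth_projection_def)
  have "G = transpose_mat (F * G)" using absorb[OF F G] t by simp
  also have "\<dots> = G * F" using transpose_mult[OF c] t by simp
  also have "\<dots> = F" by (rule absorb[OF G F])
  finally show ?thesis by simp
qed

text \<open>Existence: a symmetric idempotent of maximal trace with range inside the subspace \<open>W\<close>
  has range \<open>W\<close>.\<close>

lemma is_orth_projection_exists:
  fixes W :: "real vec set"
  assumes W: "W \<subseteq> carrier_vec n" and zero: "0\<^sub>v n \<in> W"
    and add: "\<And>x y. x \<in> W \<Longrightarrow> y \<in> W \<Longrightarrow> x + y \<in> W"
    and smult: "\<And>a x. x \<in> W \<Longrightarrow> a \<cdot>\<^sub>v x \<in> W"
  shows "\<exists>F. is_orth_projection n W F"
proof -
  define Q where "Q F \<longleftrightarrow> F \<in> carrier_mat n n \<and> transpose_mat F = F \<and> F * F = F \<and>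
    (\<forall>v\<in>carrier_vec n. F *\<^sub>v v \<in> W)" for F :: "real mat"
  define P where "P k \<longleftrightarrow> (\<exists>F. Q F \<and> (\<Sum>i<n. F $$ (i, i)) = real k)" for k :: nat
  have zv: "0\<^sub>m n n *\<^sub>v v = 0\<^sub>v n" if "v \<in> carrier_vec n" for v :: "real vec"
    using that by (intro eq_vecI) auto
  have "Q (0\<^sub>m n n)" using zero zv by (auto simp: Q_def)
  then have P0: "P 0" unfolding P_def by (intro exI[of _ "0\<^sub>m n n"]) simp
  have bound: "k \<le> n" if Pk: "P k" for k
  proof -
    obtain F where F: "Q F" "(\<Sum>i<n. F $$ (i, i)) = real k" using Pk unfolding P_def by blast
    then have c: "F \<in> carrier_mat n n" and t: "transpose_mat F = F" and id: "F * F = F"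
      by (auto simp: Q_def)
    have "F $$ (i, i) \<le> 1" if i: "i < n" for i
    proof -
      have sym: "F $$ (j, i) = F $$ (i, j)" if "j < n" for j
        using arg_cong[OF t, of "\<lambda>A. A $$ (i, j)"] c i that by simp
      have "F $$ (i, i) = (F * F) $$ (i, i)" by (simp add: id)
      also have "\<dots> = (\<Sum>j\<in>{0..<n}. F $$ (i, j) * F $$ (j, i))"
        using c i by (simp add: scalar_prod_def)
      also have "\<dots> = (\<Sum>j\<in>{0..<n}. (F $$ (i, j))\<^sup>2)"
        by (intro sum.cong) (auto simp: sym power2_eq_square)
      also have "\<dots> \<ge> (F $$ (i, i))\<^sup>2"
        by (rule member_le_sum) (use i in auto)
      finally have "F $$ (i, i) * F $$ (i, i) \<le> F $$ (i, i)" by (simp add: power2_eq_square)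
      moreover have "F $$ (i, i) * 1 < F $$ (i, i) * F $$ (i, i)" if "1 < F $$ (i, i)"
        using that by (intro mult_strict_left_mono) auto
      ultimately show ?thesis by (cases "1 < F $$ (i, i)") auto
    qed
    then have "(\<Sum>i<n. F $$ (i, i)) \<le> (\<Sum>i<n. 1)" by (intro sum_mono) auto
    then show ?thesis using F(2) by simp
  qed
  obtain k where k: "P k" and kmax: "\<And>j. P j \<Longrightarrow> j \<le> k"
    using GreatestI_nat[of P, OF P0] Greatest_le_nat[of P] bound by blast
  obtain F where QF: "Q F" and trF: "(\<Sum>i<n. F $$ (i, i)) = real k"
    using k unfolding P_def by blast
  then have c: "F \<in> carrier_mat n n" and t: "transpose_mat F = F" and id: "F * F = F"
    and range: "\<And>v. v \<in> carrier_vec n \<Longrightarrow> F *\<^sub>v v \<in> W" by (auto simp: Q_def)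
  have fixed: "F *\<^sub>v v = v" if vW: "v \<in> W" for v
  proof (rule ccontr)
    assume neq: "F *\<^sub>v v \<noteq> v"
    have v: "v \<in> carrier_vec n" using vW W by auto
    define u where "u = v + (- 1) \<cdot>\<^sub>v (F *\<^sub>v v)"
    have Fv: "F *\<^sub>v v \<in> carrier_vec n" using c v by simp
    have u: "u \<in> carrier_vec n" using v Fv by (simp add: u_def)
    have uW: "u \<in> W" unfolding u_def by (intro add smult range vW v)
    have Fu: "F *\<^sub>v u = 0\<^sub>v n"
    proof -
      have "F *\<^sub>v u = F *\<^sub>v v + (- 1) \<cdot>\<^sub>v (F *\<^sub>v (F *\<^sub>v v))"
        unfolding u_def using c v Fv
        by (simp add: mult_add_distrib_mat_vec[of _ n n] mult_mat_vec[of _ n n])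
      also have "F *\<^sub>v (F *\<^sub>v v) = F *\<^sub>v v"
        using assoc_mult_mat_vec[OF c c v] id by simp
      also have "F *\<^sub>v v + (- 1) \<cdot>\<^sub>v (F *\<^sub>v v) = 0\<^sub>v n" using c by (intro eq_vecI) auto
      finally show ?thesis .
    qed
    have "u \<noteq> 0\<^sub>v n"
    proof
      assume "u = 0\<^sub>v n"
      then have "u $ i = 0" if "i < n" for i using that by simp
      then have "F *\<^sub>v v = v" using v c by (intro eq_vecI) (auto simp: u_def)
      with neq show False by simp
    qed
    define d where "d = u \<bullet> u"
    have d0: "d \<noteq> 0"
      using conjugate_square_eq_0_vec[OF u] \<open>u \<noteq> 0\<^sub>v n\<close> by (simp add: d_def)
    define R where "R = mat n n (\<lambda>(i, j). u $ i * u $ j / d)"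
    have R: "R \<in> carrier_mat n n" by (simp add: R_def)
    have Rv: "R *\<^sub>v w = ((u \<bullet> w) / d) \<cdot>\<^sub>v u" if w: "w \<in> carrier_vec n" for w
      using u w by (intro eq_vecI)
        (auto simp: R_def scalar_prod_def sum_distrib_left sum_distrib_right
          sum_divide_distrib intro!: sum.cong)
    have tR: "transpose_mat R = R" by (intro eq_matI) (auto simp: R_def)
    have FR: "F * R = 0\<^sub>m n n"
    proof (rule mat_eq_by_mult_vec)
      fix w :: "real vec" assume w: "w \<in> carrier_vec n"
      have "F * R *\<^sub>v w = F *\<^sub>v (((u \<bullet> w) / d) \<cdot>\<^sub>v u)"
        using assoc_mult_mat_vec[OF c R w] Rv[OF w] by simp
      also have "\<dots> = 0\<^sub>m n n *\<^sub>v w"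
        using mult_mat_vec[OF c u] Fu zv[OF w] by auto
      finally show "F * R *\<^sub>v w = 0\<^sub>m n n *\<^sub>v w" .
    qed (use c R in auto)
    have "R * F = transpose_mat (F * R)" using transpose_mult[OF c R] t tR by simp
    also have "\<dots> = 0\<^sub>m n n" unfolding FR by (rule eq_matI) auto
    finally have RF: "R * F = 0\<^sub>m n n" .
    have RR: "R * R = R"
    proof (rule mat_eq_by_mult_vec)
      fix w :: "real vec" assume w: "w \<in> carrier_vec n"
      have "R * R *\<^sub>v w = R *\<^sub>v (((u \<bullet> w) / d) \<cdot>\<^sub>v u)"
        using assoc_mult_mat_vec[OF R R w] Rv[OF w] by simp
      also have "\<dots> = ((u \<bullet> w) / d) \<cdot>\<^sub>v (R *\<^sub>v u)" by (rule mult_mat_vec[OF R u])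
      also have "R *\<^sub>v u = u" using Rv[OF u] d0 by (simp add: d_def)
      finally show "R * R *\<^sub>v w = R *\<^sub>v w" using Rv[OF w] by simp
    qed (use R in auto)
    have "(F + R) * (F + R) = F * F + F * R + (R * F + R * R)"
      using add_mult_distrib_mat[OF c R add_carrier_mat[OF R, of F]] mult_add_distrib_mat[OF c c R]
        mult_add_distrib_mat[OF R c R] c R by simp
    also have "\<dots> = F + R" using c R FR RF RR id by simp
    finally have idem: "(F + R) * (F + R) = F + R" .
    have "transpose_mat (F + R) = F + R" using transpose_add[OF c R] t tR by simp
    moreover have "(F + R) *\<^sub>v w \<in> W" if w: "w \<in> carrier_vec n" for w
      using add_mult_distrib_mat_vec[OF c R w] Rv[OF w] add[OF range[OF w] smult[OF uW]] by simp
    ultimately have "Q (F + R)" using idem c R by (auto simp: Q_def)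
    moreover have "(\<Sum>i<n. (F + R) $$ (i, i)) = real (Suc k)"
    proof -
      have "(\<Sum>i<n. (F + R) $$ (i, i)) = (\<Sum>i<n. F $$ (i, i)) + (\<Sum>i<n. R $$ (i, i))"
        using c R by (simp add: sum.distrib)
      moreover have "(\<Sum>i<n. R $$ (i, i)) = (\<Sum>i<n. u $ i * u $ i) / d"
        by (simp add: R_def sum_divide_distrib)
      moreover have "(\<Sum>i<n. u $ i * u $ i) = d"
        using u by (simp add: d_def scalar_prod_def lessThan_atLeast0)
      ultimately show ?thesis using trF d0 by simp
    qed
    ultimately have "P (Suc k)" unfolding P_def by blast
    then show False using kmax by fastforce
  qed
  have "(\<lambda>v. F *\<^sub>v v) ` carrier_vec n = W"
  proof (intro equalityI subsetI)
    fix v assume "v \<in> W"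
    then show "v \<in> (\<lambda>v. F *\<^sub>v v) ` carrier_vec n"
      using fixed[of v] W by (intro image_eqI[of _ _ v]) auto
  qed (use range in auto)
  then show ?thesis using c t id by (auto simp: is_orth_projection_def)
qed

text \<open>Hence the definite description of the eigenprojection is proper for every square matrix.\<close>

lemma is_orth_projection_eigenprojection:
  assumes B: "B \<in> carrier_mat n n"
  shows "is_orth_projection n (eigenspace B \<theta>) (eigenprojection B \<theta>)"
proof -
  have dim: "dim_row B = n" using B by simp
  have "\<exists>F. is_orth_projection n (eigenspace B \<theta>) F"
  proof (rule is_orth_projection_exists)
    fix x y assume "x \<in> eigenspace B \<theta>" "y \<in> eigenspace B \<theta>"
    then show "x + y \<in> eigenspace B \<theta>"
      using B by (simp add: eigenspace_def mult_add_distrib_mat_vec[of _ n n]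
        smult_add_distrib_vec[of _ n])
  next
    fix a x assume "x \<in> eigenspace B \<theta>"
    then show "a \<cdot>\<^sub>v x \<in> eigenspace B \<theta>"
      using B by (simp add: eigenspace_def mult_mat_vec[of _ n n] smult_smult_assoc mult.commute)
  qed (use B in \<open>auto simp: eigenspace_def\<close>)
  then have "\<exists>!F. is_orth_projection n (eigenspace B \<theta>) F"
    using is_orth_projection_unique by blast
  then show ?thesis unfolding eigenprojection_def dim by (rule theI')
qed

section \<open>Quantum state transfer\<close>

definition is_state :: "nat \<Rightarrow> real vec \<Rightarrow> bool" where
  "is_state n x \<longleftrightarrow> x \<in> carrier_vec n \<and> x \<bullet> x = 1"

definition mat_exp :: "complex mat \<Rightarrow> complex mat" where
  "mat_exp A = mat (dim_row A) (dim_row A) (\<lambda>(i, j). \<Sum>k. (A ^\<^sub>m k) $$ (i, j) / fact k)"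

definition transition_mat :: "real mat \<Rightarrow> real \<Rightarrow> complex mat" where
  "transition_mat B t = mat_exp ((\<i> * complex_of_real t) \<cdot>\<^sub>m map_mat complex_of_real B)"

definition lin_indep_pair :: "real vec \<Rightarrow> real vec \<Rightarrow> bool" where
  "lin_indep_pair x y \<longleftrightarrow>
    (\<forall>a b. a \<cdot>\<^sub>v x + b \<cdot>\<^sub>v y = 0\<^sub>v (dim_vec x) \<longrightarrow> a = 0 \<and> b = 0)"

definition strongly_cospectral :: "real mat \<Rightarrow> real vec \<Rightarrow> real vec \<Rightarrow> bool" where
  "strongly_cospectral B x y \<longleftrightarrow>
    is_state (dim_row B) x \<and> is_state (dim_row B) y \<and> lin_indep_pair x y \<and>
    (\<forall>\<theta>. eigenvalue B \<theta> \<longrightarrow> eigenprojection B \<theta> *\<^sub>v x \<noteq> 0\<^sub>v (dim_row B) \<longrightarrow>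
      eigenprojection B \<theta> *\<^sub>v x = eigenprojection B \<theta> *\<^sub>v y \<or>
      eigenprojection B \<theta> *\<^sub>v x = - (eigenprojection B \<theta> *\<^sub>v y))"

definition PST :: "real mat \<Rightarrow> real vec \<Rightarrow> real vec \<Rightarrow> bool" where
  "PST B x y \<longleftrightarrow> is_state (dim_row B) x \<and> is_state (dim_row B) y \<and>
    (\<exists>\<tau>>0. \<exists>\<gamma>. transition_mat B \<tau> *\<^sub>v map_vec complex_of_real x =
      \<gamma> \<cdot>\<^sub>v map_vec complex_of_real y)"

definition periodic :: "real mat \<Rightarrow> real vec \<Rightarrow> bool" where
  "periodic B x \<longleftrightarrow> PST B x x"

text \<open>Convergence of vectors is expressed componentwise.\<close>

definition PGST :: "real mat \<Rightarrow> real vec \<Rightarrow> real vec \<Rightarrow> bool" where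
  "PGST B x y \<longleftrightarrow> is_state (dim_row B) x \<and> is_state (dim_row B) y \<and> lin_indep_pair x y \<and>
    (\<exists>(\<tau> :: nat \<Rightarrow> real) \<gamma>. cmod \<gamma> = 1 \<and>
      (\<forall>i<dim_row B.
        (\<lambda>k. (transition_mat B (\<tau> k) *\<^sub>v map_vec complex_of_real x) $ i)
          \<longlonglongrightarrow> (\<gamma> \<cdot>\<^sub>v map_vec complex_of_real y) $ i))"

definition sedentary :: "real \<Rightarrow> real mat \<Rightarrow> real vec \<Rightarrow> bool" where
  "sedentary C B x \<longleftrightarrow> is_state (dim_row B) x \<and> 0 < C \<and> C \<le> 1 \<and>
    C \<le> (INF t\<in>{0<..}. cmod (map_vec complex_of_real x \<bullet>
      (transition_mat B t *\<^sub>v map_vec complex_of_real x)))"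

end

theory Submission
  imports Defs
begin

text \<open>The columns of \<open>M\<close> form an orthonormal basis of the vertex space adapted to the
  involution: functions that change sign under \<open>\<phi>\<close> come first, functions invariant under
  \<open>\<phi>\<close> second. Adjacency, degree and potential are all preserved by \<open>\<phi>\<close>, so
  the \<open>q\<close>-Laplacian \<open>L\<close> commutes with the permutation matrix of \<open>\<phi>\<close> and leaves both
  eigenspaces of that permutation invariant. In the basis \<open>M\<close> it is therefore block diagonal, and
  the two blocks are those of \<open>N\<close>. Thus \<open>M\<close> is orthogonal (\<open>M_mat_orthogonal\<close>) and
  \<open>L * M = M * N\<close> (\<open>M_mat_intertwines\<close>, whose hypotheses \<open>qlaplacian_half_swap\<close> and the
  symmetry of \<open>adj\<close> provide).

  All five properties are invariant under a real orthogonal similarity. It carries eigenspaces to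
  eigenspaces and, as it preserves the inner product, eigenprojections to eigenprojections
  (\<open>eigenprojection_conjugate\<close>). It also intertwines the powers of the two matrices, hence their
  exponential series and the transition matrices (\<open>transition_mat_vec\<close>), while return amplitudes
  are unchanged (\<open>return_amplitude\<close>). These facts form the locale \<open>orthogonal_similarity\<close>,
  in which \<open>N\<close> and \<open>L\<close> play the roles of \<open>C\<close> and \<open>B\<close>.\<close>

section \<open>Matrix exponentials along an intertwining matrix\<close>

text \<open>The sum of the moduli of all entries is a submultiplicative matrix norm that dominates every
  entry. The bound makes the exponential series converge entrywise, which is what allows it to be
  multiplied by a fixed matrix term by term.\<close>

lemma norm_mat_power_entry_le:
  fixes A :: "complex mat"
  assumes A: "A \<in> carrier_mat n n" and i: "i < n" and j: "j < n"
  shows "norm ((A ^\<^sub>m k) $$ (i, j)) \<le> (\<Sum>a<n. \<Sum>b<n. norm (A $$ (a, b))) ^ k"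
  using i j
proof (induction k arbitrary: j)
  case 0
  then show ?case using A by auto
next
  case (Suc k)
  let ?K = "\<Sum>a<n. \<Sum>b<n. norm (A $$ (a, b))"
  have entry: "(A ^\<^sub>m Suc k) $$ (i, j) = (\<Sum>l<n. (A ^\<^sub>m k) $$ (i, l) * A $$ (l, j))"
    using A Suc.prems by (simp add: scalar_prod_def lessThan_atLeast0)
  have K0: "0 \<le> ?K" by (intro sum_nonneg) auto
  have "norm ((A ^\<^sub>m Suc k) $$ (i, j)) \<le> (\<Sum>l<n. norm ((A ^\<^sub>m k) $$ (i, l)) * norm (A $$ (l, j)))"
    unfolding entry by (rule order_trans[OF norm_sum]) (simp add: norm_mult)
  also have "\<dots> \<le> (\<Sum>l<n. ?K ^ k * (\<Sum>b<n. norm (A $$ (l, b))))"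
  proof (rule sum_mono)
    fix l assume "l \<in> {..<n}"
    then show "norm ((A ^\<^sub>m k) $$ (i, l)) * norm (A $$ (l, j)) \<le>
        ?K ^ k * (\<Sum>b<n. norm (A $$ (l, b)))"
      using Suc.IH[of l] Suc.prems K0
      by (intro mult_mono member_le_sum) (auto intro: zero_le_power)
  qed
  also have "\<dots> = ?K ^ Suc k" unfolding sum_distrib_left[symmetric] by (simp add: mult.commute)
  finally show ?case .
qed

lemma summable_mat_exp_entry:
  fixes A :: "complex mat"
  assumes "A \<in> carrier_mat n n" "i < n" "j < n"
  shows "summable (\<lambda>k. (A ^\<^sub>m k) $$ (i, j) / fact k)"
proof (rule summable_comparison_test')
  let ?K = "\<Sum>a<n. \<Sum>b<n. norm (A $$ (a, b))"
  show "summable (\<lambda>k. ?K ^ k / fact k)"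
    using summable_exp[of ?K] by (simp add: field_simps)
  show "norm ((A ^\<^sub>m k) $$ (i, j) / fact k) \<le> ?K ^ k / fact k" for k
    using norm_mat_power_entry_le[OF assms] by (simp add: norm_divide divide_right_mono)
qed

lemma pow_mat_intertwine:
  fixes A B P :: "'b :: comm_ring_1 mat"
  assumes A: "A \<in> carrier_mat n n" and B: "B \<in> carrier_mat n n" and P: "P \<in> carrier_mat n n"
    and AP: "A * P = P * B"
  shows "A ^\<^sub>m k * P = P * B ^\<^sub>m k"
proof (induction k)
  case 0
  then show ?case using A B P by simp
next
  case (Suc k)
  have Ak: "A ^\<^sub>m k \<in> carrier_mat n n" and Bk: "B ^\<^sub>m k \<in> carrier_mat n n" using A B by auto
  have "A ^\<^sub>m Suc k * P = A ^\<^sub>m k * (P * B)"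
    using assoc_mult_mat[OF Ak A P] AP by simp
  also have "\<dots> = P * B ^\<^sub>m k * B" using assoc_mult_mat[OF Ak P B] Suc.IH by simp
  also have "\<dots> = P * B ^\<^sub>m Suc k" using assoc_mult_mat[OF P Bk B] by simp
  finally show ?case .
qed

lemma mat_exp_carrier: "A \<in> carrier_mat n n \<Longrightarrow> mat_exp A \<in> carrier_mat n n"
  by (simp add: mat_exp_def)

text \<open>The relation \<open>A * P = P * B\<close> passes to all powers and, multiplication by \<open>P\<close> being a finite
  combination of entries, to the limit of the series.\<close>

lemma mat_exp_intertwine:
  assumes A: "A \<in> carrier_mat n n" and B: "B \<in> carrier_mat n n" and P: "P \<in> carrier_mat n n"
    and AP: "A * P = P * B"
  shows "mat_exp A * P = P * mat_exp B"
proof (rule eq_matI)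
  fix i j assume "i < dim_row (P * mat_exp B)" "j < dim_col (P * mat_exp B)"
  then have i: "i < n" and j: "j < n" using P B by (auto simp: mat_exp_def)
  have "(mat_exp A * P) $$ (i, j) = (\<Sum>l<n. (\<Sum>k. (A ^\<^sub>m k) $$ (i, l) / fact k) * P $$ (l, j))"
    using A P i j by (simp add: mat_exp_def scalar_prod_def lessThan_atLeast0)
  also have "\<dots> = (\<Sum>l<n. \<Sum>k. (A ^\<^sub>m k) $$ (i, l) / fact k * P $$ (l, j))"
    by (intro sum.cong refl suminf_mult2 summable_mat_exp_entry[OF A i]) auto
  also have "\<dots> = (\<Sum>k. \<Sum>l<n. (A ^\<^sub>m k) $$ (i, l) / fact k * P $$ (l, j))"
    by (intro suminf_sum[symmetric] summable_mult2 summable_mat_exp_entry[OF A i]) auto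
  also have "\<dots> = (\<Sum>k. (A ^\<^sub>m k * P) $$ (i, j) / fact k)"
    using A P i j by (simp add: scalar_prod_def lessThan_atLeast0 sum_divide_distrib)
  also have "\<dots> = (\<Sum>k. \<Sum>l<n. P $$ (i, l) * ((B ^\<^sub>m k) $$ (l, j) / fact k))"
    unfolding pow_mat_intertwine[OF A B P AP]
    using B P i j by (simp add: scalar_prod_def lessThan_atLeast0 sum_divide_distrib)
  also have "\<dots> = (\<Sum>l<n. \<Sum>k. P $$ (i, l) * ((B ^\<^sub>m k) $$ (l, j) / fact k))"
    by (intro suminf_sum summable_mult summable_mat_exp_entry[OF B _ j]) auto
  also have "\<dots> = (\<Sum>l<n. P $$ (i, l) * (\<Sum>k. (B ^\<^sub>m k) $$ (l, j) / fact k))"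
    by (intro sum.cong refl suminf_mult summable_mat_exp_entry[OF B _ j]) auto
  also have "\<dots> = (P * mat_exp B) $$ (i, j)"
    using B P i j by (simp add: mat_exp_def scalar_prod_def lessThan_atLeast0)
  finally show "(mat_exp A * P) $$ (i, j) = (P * mat_exp B) $$ (i, j)" .
qed (use A B P in \<open>auto simp: mat_exp_def\<close>)

lemma transition_mat_carrier: "B \<in> carrier_mat n n \<Longrightarrow> transition_mat B t \<in> carrier_mat n n"
  unfolding transition_mat_def by (rule mat_exp_carrier) auto


section \<open>Orthogonally similar matrices\<close>

locale orthogonal_similarity =
  fixes n :: nat and M B C :: "real mat"
  assumes M: "M \<in> carrier_mat n n" and B: "B \<in> carrier_mat n n" and C: "C \<in> carrier_mat n n"
    and left_inverse: "transpose_mat M * M = 1\<^sub>m n"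
    and intertwine: "B * M = M * C"
begin

lemma MT: "transpose_mat M \<in> carrier_mat n n"
  using M by simp

lemma right_inverse: "M * transpose_mat M = 1\<^sub>m n"
  by (rule mat_mult_left_right_inverse[OF MT M left_inverse])

lemma transpose_mult_vec: "x \<in> carrier_vec n \<Longrightarrow> transpose_mat M *\<^sub>v (M *\<^sub>v x) = x"
  using assoc_mult_mat_vec[OF MT M] left_inverse by simp

lemma mult_transpose_vec: "x \<in> carrier_vec n \<Longrightarrow> M *\<^sub>v (transpose_mat M *\<^sub>v x) = x"
  using assoc_mult_mat_vec[OF M MT] right_inverse by simp

lemma mult_vec_carrier: "x \<in> carrier_vec n \<Longrightarrow> M *\<^sub>v x \<in> carrier_vec n"
  using M by simp

text \<open>Similarity is symmetric because the inverse of \<open>M\<close> is again orthogonal. Implications from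
  \<open>C\<close> to \<open>B\<close> therefore yield their converses.\<close>

lemma inverse_similarity: "orthogonal_similarity n (transpose_mat M) C B"
proof
  have "C * transpose_mat M = transpose_mat M * M * C * transpose_mat M"
    using left_inverse C by simp
  also have "\<dots> = transpose_mat M * (M * C) * transpose_mat M"
    using assoc_mult_mat[OF MT M C] by simp
  also have "\<dots> = transpose_mat M * (B * M) * transpose_mat M" by (simp add: intertwine)
  also have "\<dots> = transpose_mat M * (B * M * transpose_mat M)"
    using assoc_mult_mat[OF MT mult_carrier_mat[OF B M] MT] .
  also have "B * M * transpose_mat M = B"
    using assoc_mult_mat[OF B M MT] right_inverse B by simp
  finally show "C * transpose_mat M = transpose_mat M * B" .
qed (use M B C right_inverse in auto)

lemma inner_product:
  assumes "x \<in> carrier_vec n" "y \<in> carrier_vec n"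
  shows "(M *\<^sub>v x) \<bullet> (M *\<^sub>v y) = x \<bullet> y"
  using transpose_vec_mult_scalar[OF M assms(2) mult_vec_carrier[OF assms(1)]]
    transpose_mult_vec[OF assms(1)] by simp

lemma state: "is_state n x \<Longrightarrow> is_state n (M *\<^sub>v x)"
  unfolding is_state_def using inner_product mult_vec_carrier by simp

lemma mult_vec_eq_iff:
  assumes "x \<in> carrier_vec n" "y \<in> carrier_vec n"
  shows "M *\<^sub>v x = M *\<^sub>v y \<longleftrightarrow> x = y"
  using transpose_mult_vec assms by metis

lemma mult_zero_vec: "M *\<^sub>v 0\<^sub>v n = 0\<^sub>v n"
  using M by (intro eq_vecI) auto

lemma mult_uminus_vec: "x \<in> carrier_vec n \<Longrightarrow> M *\<^sub>v (- x) = - (M *\<^sub>v x)"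
  using M by (intro eq_vecI) auto

lemma lin_indep:
  assumes x: "x \<in> carrier_vec n" and y: "y \<in> carrier_vec n" and ind: "lin_indep_pair x y"
  shows "lin_indep_pair (M *\<^sub>v x) (M *\<^sub>v y)"
  unfolding lin_indep_pair_def
proof (intro allI impI)
  fix a b assume "a \<cdot>\<^sub>v (M *\<^sub>v x) + b \<cdot>\<^sub>v (M *\<^sub>v y) = 0\<^sub>v (dim_vec (M *\<^sub>v x))"
  then have "M *\<^sub>v (a \<cdot>\<^sub>v x + b \<cdot>\<^sub>v y) = M *\<^sub>v 0\<^sub>v n"
    using x y M by (simp add: mult_add_distrib_mat_vec[of _ n n] mult_mat_vec[of _ n n] mult_zero_vec)
  then have "a \<cdot>\<^sub>v x + b \<cdot>\<^sub>v y = 0\<^sub>v n" using x y by (subst (asm) mult_vec_eq_iff) auto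
  then show "a = 0 \<and> b = 0" using ind x unfolding lin_indep_pair_def by auto
qed

lemma intertwine_vec: "x \<in> carrier_vec n \<Longrightarrow> B *\<^sub>v (M *\<^sub>v x) = M *\<^sub>v (C *\<^sub>v x)"
  using assoc_mult_mat_vec[OF B M] assoc_mult_mat_vec[OF M C] intertwine by metis

lemma eigenspace_iff:
  assumes x: "x \<in> carrier_vec n"
  shows "M *\<^sub>v x \<in> eigenspace B \<theta> \<longleftrightarrow> x \<in> eigenspace C \<theta>"
proof -
  have "M *\<^sub>v x \<in> eigenspace B \<theta> \<longleftrightarrow> M *\<^sub>v (C *\<^sub>v x) = M *\<^sub>v (\<theta> \<cdot>\<^sub>v x)"
    using x M B intertwine_vec[OF x] by (simp add: eigenspace_def mult_mat_vec[of _ n n])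
  also have "\<dots> \<longleftrightarrow> C *\<^sub>v x = \<theta> \<cdot>\<^sub>v x" using x C by (intro mult_vec_eq_iff) auto
  finally show ?thesis using x C by (simp add: eigenspace_def)
qed

lemma eigenspace_image: "eigenspace B \<theta> = (\<lambda>x. M *\<^sub>v x) ` eigenspace C \<theta>"
proof (intro equalityI subsetI)
  fix v assume v: "v \<in> eigenspace B \<theta>"
  then have c: "v \<in> carrier_vec n" using B by (simp add: eigenspace_def)
  show "v \<in> (\<lambda>x. M *\<^sub>v x) ` eigenspace C \<theta>"
    using v c eigenspace_iff[of "transpose_mat M *\<^sub>v v" \<theta>] mult_transpose_vec[OF c] M
    by (intro image_eqI[of _ _ "transpose_mat M *\<^sub>v v"]) auto
qed (use eigenspace_iff C in \<open>auto simp: eigenspace_def\<close>)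

lemma eigenvalue_imp: "eigenvalue C \<theta> \<Longrightarrow> eigenvalue B \<theta>"
proof -
  assume "eigenvalue C \<theta>"
  then obtain v where v: "v \<in> carrier_vec n" "v \<noteq> 0\<^sub>v n" "C *\<^sub>v v = \<theta> \<cdot>\<^sub>v v"
    using C by (auto simp: eigenvalue_def eigenvector_def)
  then have "M *\<^sub>v v \<in> eigenspace B \<theta>" "M *\<^sub>v v \<noteq> 0\<^sub>v n"
    using C eigenspace_iff[of v] mult_vec_eq_iff[of v "0\<^sub>v n"] mult_zero_vec
    by (auto simp: eigenspace_def)
  then show ?thesis using B by (auto simp: eigenvalue_def eigenvector_def eigenspace_def)
qed

text \<open>An orthogonal projection is determined by its range, so it suffices that conjugation by \<open>M\<close>
  yields a symmetric idempotent with range \<open>M\<close> applied to the eigenspace of \<open>C\<close>. Symmetry is the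
  point where the inverse of \<open>M\<close> has to be its transpose.\<close>

lemma eigenprojection_conjugate:
  "eigenprojection B \<theta> = M * eigenprojection C \<theta> * transpose_mat M"
proof (rule is_orth_projection_unique)
  show "is_orth_projection n (eigenspace B \<theta>) (eigenprojection B \<theta>)"
    by (rule is_orth_projection_eigenprojection[OF B])
  define F where "F = eigenprojection C \<theta>"
  have F: "F \<in> carrier_mat n n" and tF: "transpose_mat F = F" and idem: "F * F = F"
    and image: "(\<lambda>v. F *\<^sub>v v) ` carrier_vec n = eigenspace C \<theta>"
    using is_orth_projection_eigenprojection[OF C, of \<theta>]
    by (auto simp: F_def is_orth_projection_def)
  have MF: "M * F \<in> carrier_mat n n" using M F by simp
  have mv: "M * F * transpose_mat M *\<^sub>v v = M *\<^sub>v (F *\<^sub>v (transpose_mat M *\<^sub>v v))"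
    if "v \<in> carrier_vec n" for v
    using that M F MT by (simp add: assoc_mult_mat_vec[of _ n n _ n])
  have "transpose_mat (M * F * transpose_mat M) = M * (F * transpose_mat M)"
    using transpose_mult[OF MF MT] transpose_mult[OF M F] tF by simp
  then have sym: "transpose_mat (M * F * transpose_mat M) = M * F * transpose_mat M"
    using assoc_mult_mat[OF M F MT] by simp
  have "M * F * transpose_mat M * (M * F * transpose_mat M) = M * F * transpose_mat M"
  proof (rule mat_eq_by_mult_vec)
    fix v :: "real vec" assume v: "v \<in> carrier_vec n"
    let ?w = "transpose_mat M *\<^sub>v v"
    have w: "?w \<in> carrier_vec n" "F *\<^sub>v ?w \<in> carrier_vec n" using MT F v by auto
    have "M * F * transpose_mat M * (M * F * transpose_mat M) *\<^sub>v v =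
        M * F * transpose_mat M *\<^sub>v (M *\<^sub>v (F *\<^sub>v ?w))"
      using assoc_mult_mat_vec[of "M * F * transpose_mat M" n n "M * F * transpose_mat M" n v]
        mv[OF v] v M F by simp
    also have "\<dots> = M *\<^sub>v (F *\<^sub>v (F *\<^sub>v ?w))"
      using mv[OF mult_vec_carrier[OF w(2)]] transpose_mult_vec[OF w(2)] by simp
    also have "F *\<^sub>v (F *\<^sub>v ?w) = F *\<^sub>v ?w" using assoc_mult_mat_vec[OF F F w(1)] idem by simp
    finally show "M * F * transpose_mat M * (M * F * transpose_mat M) *\<^sub>v v =
        M * F * transpose_mat M *\<^sub>v v" using mv[OF v] by simp
  qed (use M F in auto)
  moreover have "(\<lambda>v. M * F * transpose_mat M *\<^sub>v v) ` carrier_vec n = eigenspace B \<theta>"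
  proof -
    have "(\<lambda>v. transpose_mat M *\<^sub>v v) ` carrier_vec n = carrier_vec n"
    proof (intro equalityI subsetI)
      fix v :: "real vec" assume "v \<in> carrier_vec n"
      then show "v \<in> (\<lambda>v. transpose_mat M *\<^sub>v v) ` carrier_vec n"
        using transpose_mult_vec mult_vec_carrier by (intro image_eqI[of _ _ "M *\<^sub>v v"]) auto
    qed (use MT in auto)
    moreover have "(\<lambda>v. M * F * transpose_mat M *\<^sub>v v) ` carrier_vec n =
        (\<lambda>v. M *\<^sub>v v) ` (\<lambda>v. F *\<^sub>v v) ` (\<lambda>v. transpose_mat M *\<^sub>v v) ` carrier_vec n"
      unfolding image_image by (intro image_cong refl mv)
    ultimately show ?thesis using image eigenspace_image by simp
  qed
  ultimately show "is_orth_projection n (eigenspace B \<theta>)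
      (M * eigenprojection C \<theta> * transpose_mat M)"
    using sym M F unfolding F_def[symmetric] is_orth_projection_def by auto
qed

lemma eigenprojection_carrier: "eigenprojection C \<theta> \<in> carrier_mat n n"
  using is_orth_projection_eigenprojection[OF C, of \<theta>] by (simp add: is_orth_projection_def)

lemma eigenprojection_vec:
  assumes x: "x \<in> carrier_vec n"
  shows "eigenprojection B \<theta> *\<^sub>v (M *\<^sub>v x) = M *\<^sub>v (eigenprojection C \<theta> *\<^sub>v x)"
  unfolding eigenprojection_conjugate
  using x M MT eigenprojection_carrier transpose_mult_vec[OF x]
  by (simp add: assoc_mult_mat_vec[of _ n n _ n])

lemma strongly_cospectral_imp:
  assumes sc: "strongly_cospectral C x y"
  shows "strongly_cospectral B (M *\<^sub>v x) (M *\<^sub>v y)"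
proof -
  have dim: "dim_row B = n" "dim_row C = n" using B C by auto
  have st: "is_state n x" "is_state n y" and ind: "lin_indep_pair x y"
    using sc by (auto simp: strongly_cospectral_def dim)
  then have x: "x \<in> carrier_vec n" and y: "y \<in> carrier_vec n" by (auto simp: is_state_def)
  interpret inv: orthogonal_similarity n "transpose_mat M" C B by (rule inverse_similarity)
  have "eigenprojection B \<theta> *\<^sub>v (M *\<^sub>v x) = eigenprojection B \<theta> *\<^sub>v (M *\<^sub>v y) \<or>
      eigenprojection B \<theta> *\<^sub>v (M *\<^sub>v x) = - (eigenprojection B \<theta> *\<^sub>v (M *\<^sub>v y))"
    if ev: "eigenvalue B \<theta>" and nz: "eigenprojection B \<theta> *\<^sub>v (M *\<^sub>v x) \<noteq> 0\<^sub>v n" for \<theta>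
  proof -
    have "eigenprojection C \<theta> *\<^sub>v x \<noteq> 0\<^sub>v n"
      using nz eigenprojection_vec[OF x] mult_zero_vec by auto
    then have "eigenprojection C \<theta> *\<^sub>v x = eigenprojection C \<theta> *\<^sub>v y \<or>
        eigenprojection C \<theta> *\<^sub>v x = - (eigenprojection C \<theta> *\<^sub>v y)"
      using sc inv.eigenvalue_imp[OF ev] by (auto simp: strongly_cospectral_def dim)
    moreover have "eigenprojection C \<theta> *\<^sub>v y \<in> carrier_vec n"
      by (rule mult_mat_vec_carrier[OF eigenprojection_carrier y])
    ultimately show ?thesis using eigenprojection_vec x y mult_uminus_vec by metis
  qed
  then show ?thesis
    using state st lin_indep[OF x y ind] by (auto simp: strongly_cospectral_def dim)
qed

abbreviation cplx :: "real vec \<Rightarrow> complex vec" where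
  "cplx x \<equiv> map_vec complex_of_real x"

abbreviation M\<^sub>c :: "complex mat" where
  "M\<^sub>c \<equiv> map_mat complex_of_real M"

lemma Mc: "M\<^sub>c \<in> carrier_mat n n"
  using M by simp

lemma cplx_mult_vec: "x \<in> carrier_vec n \<Longrightarrow> cplx (M *\<^sub>v x) = M\<^sub>c *\<^sub>v cplx x"
  by (rule of_real_hom.mult_mat_vec_hom[OF M])

text \<open>Evolving in the coordinates of \<open>C\<close> and then changing to those of \<open>B\<close> is the same as changing
  coordinates first. Every statement about state transfer rests on this.\<close>

lemma transition_mat_vec:
  assumes x: "x \<in> carrier_vec n"
  shows "transition_mat B t *\<^sub>v cplx (M *\<^sub>v x) = M\<^sub>c *\<^sub>v (transition_mat C t *\<^sub>v cplx x)"
proof -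
  have "map_mat complex_of_real B * M\<^sub>c = M\<^sub>c * map_mat complex_of_real C"
    unfolding of_real_hom.mat_hom_mult[OF B M, symmetric]
      of_real_hom.mat_hom_mult[OF M C, symmetric] intertwine ..
  then have "transition_mat B t * M\<^sub>c = M\<^sub>c * transition_mat C t"
    unfolding transition_mat_def using M B C
    by (intro mat_exp_intertwine[of _ n])
      (auto simp: mult_smult_distrib[of _ n n _ n] mult_smult_assoc_mat[of _ n n _ n])
  moreover have "cplx x \<in> carrier_vec n" using x by simp
  ultimately show ?thesis
    using assoc_mult_mat_vec[OF transition_mat_carrier[OF B] Mc]
      assoc_mult_mat_vec[OF Mc transition_mat_carrier[OF C]] cplx_mult_vec[OF x] by metis
qed

lemma PST_imp:
  assumes "PST C x y"
  shows "PST B (M *\<^sub>v x) (M *\<^sub>v y)"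
proof -
  have dim: "dim_row B = n" "dim_row C = n" using B C by auto
  obtain \<tau> \<gamma> where st: "is_state n x" "is_state n y" and \<tau>: "\<tau> > 0"
    and eq: "transition_mat C \<tau> *\<^sub>v cplx x = \<gamma> \<cdot>\<^sub>v cplx y"
    using assms by (auto simp: PST_def dim)
  have x: "x \<in> carrier_vec n" and y: "y \<in> carrier_vec n" using st by (auto simp: is_state_def)
  have "cplx y \<in> carrier_vec n" using y by simp
  then have "transition_mat B \<tau> *\<^sub>v cplx (M *\<^sub>v x) = \<gamma> \<cdot>\<^sub>v cplx (M *\<^sub>v y)"
    using transition_mat_vec[OF x] eq cplx_mult_vec[OF y] mult_mat_vec[OF Mc] by simp
  then show ?thesis using state st \<tau> by (auto simp: PST_def dim)
qed

lemma PGST_imp: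
  assumes "PGST C x y"
  shows "PGST B (M *\<^sub>v x) (M *\<^sub>v y)"
proof -
  have dim: "dim_row B = n" "dim_row C = n" using B C by auto
  obtain \<tau> \<gamma> where st: "is_state n x" "is_state n y" and ind: "lin_indep_pair x y"
    and \<gamma>: "cmod \<gamma> = 1"
    and lim: "\<And>i. i < n \<Longrightarrow> (\<lambda>k. (transition_mat C (\<tau> k) *\<^sub>v cplx x) $ i)
      \<longlonglongrightarrow> (\<gamma> \<cdot>\<^sub>v cplx y) $ i"
    using assms by (auto simp: PGST_def dim)
  have x: "x \<in> carrier_vec n" and y: "y \<in> carrier_vec n" using st by (auto simp: is_state_def)
  have cy: "cplx y \<in> carrier_vec n" using y by simp
  have entry: "(M\<^sub>c *\<^sub>v v) $ i = (\<Sum>l<n. M\<^sub>c $$ (i, l) * v $ l)"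
    if "i < n" "v \<in> carrier_vec n" for i v
    using that Mc by (simp add: scalar_prod_def lessThan_atLeast0)
  have Uc: "transition_mat C (\<tau> k) *\<^sub>v cplx x \<in> carrier_vec n" for k
    using x by (intro mult_mat_vec_carrier[OF transition_mat_carrier[OF C]]) simp
  have "(\<lambda>k. (transition_mat B (\<tau> k) *\<^sub>v cplx (M *\<^sub>v x)) $ i)
      \<longlonglongrightarrow> (\<gamma> \<cdot>\<^sub>v cplx (M *\<^sub>v y)) $ i" if i: "i < n" for i
  proof -
    have "(\<lambda>k. \<Sum>l<n. M\<^sub>c $$ (i, l) * (transition_mat C (\<tau> k) *\<^sub>v cplx x) $ l)
        \<longlonglongrightarrow> (\<Sum>l<n. M\<^sub>c $$ (i, l) * (\<gamma> \<cdot>\<^sub>v cplx y) $ l)"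
      by (intro tendsto_sum tendsto_mult tendsto_const lim) auto
    moreover have "\<gamma> \<cdot>\<^sub>v cplx (M *\<^sub>v y) = M\<^sub>c *\<^sub>v (\<gamma> \<cdot>\<^sub>v cplx y)"
      using cplx_mult_vec[OF y] mult_mat_vec[OF Mc cy] by simp
    ultimately show ?thesis
      using entry[OF i] Uc cy transition_mat_vec[OF x] by simp
  qed
  then show ?thesis
    using state st lin_indep[OF x y ind] \<gamma> unfolding PGST_def dim by blast
qed

text \<open>The pairing \<open>\<bullet>\<close> is bilinear over the complex numbers, without conjugation; it is preserved
  because \<open>M\<close> is real, so that its complexification still has its transpose as inverse.\<close>

lemma return_amplitude:
  assumes x: "x \<in> carrier_vec n"
  shows "cplx (M *\<^sub>v x) \<bullet> (transition_mat B t *\<^sub>v cplx (M *\<^sub>v x)) =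
    cplx x \<bullet> (transition_mat C t *\<^sub>v cplx x)"
proof -
  have cx: "cplx x \<in> carrier_vec n" using x by simp
  have Uc: "transition_mat C t *\<^sub>v cplx x \<in> carrier_vec n"
    by (rule mult_mat_vec_carrier[OF transition_mat_carrier[OF C] cx])
  have "transpose_mat M\<^sub>c * M\<^sub>c = map_mat complex_of_real (transpose_mat M * M)"
    unfolding of_real_hom.mat_hom_mult[OF MT M] by (simp add: map_mat_transpose)
  also have "\<dots> = 1\<^sub>m n" unfolding left_inverse by (rule of_real_hom.mat_hom_one)
  finally have "transpose_mat M\<^sub>c *\<^sub>v (M\<^sub>c *\<^sub>v cplx x) = cplx x"
    using assoc_mult_mat_vec[of "transpose_mat M\<^sub>c" n n "M\<^sub>c" n "cplx x"] Mc cx by simp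
  moreover have "M\<^sub>c *\<^sub>v cplx x \<in> carrier_vec n" by (rule mult_mat_vec_carrier[OF Mc cx])
  ultimately show ?thesis
    using transpose_vec_mult_scalar[OF Mc Uc, of "M\<^sub>c *\<^sub>v cplx x"]
      transition_mat_vec[OF x] cplx_mult_vec[OF x] by simp
qed

lemma sedentary_imp:
  assumes "sedentary K C x"
  shows "sedentary K B (M *\<^sub>v x)"
proof -
  have dim: "dim_row B = n" "dim_row C = n" using B C by auto
  have st: "is_state n x" using assms by (simp add: sedentary_def dim)
  then have x: "x \<in> carrier_vec n" by (simp add: is_state_def)
  show ?thesis using assms state[OF st] by (simp add: sedentary_def dim return_amplitude[OF x])
qed

lemma strongly_cospectral_iff:
  assumes "x \<in> carrier_vec n" "y \<in> carrier_vec n"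
  shows "strongly_cospectral C x y \<longleftrightarrow> strongly_cospectral B (M *\<^sub>v x) (M *\<^sub>v y)"
  using strongly_cospectral_imp assms transpose_mult_vec
    orthogonal_similarity.strongly_cospectral_imp[OF inverse_similarity] by metis

lemma PST_iff:
  assumes "x \<in> carrier_vec n" "y \<in> carrier_vec n"
  shows "PST C x y \<longleftrightarrow> PST B (M *\<^sub>v x) (M *\<^sub>v y)"
  using PST_imp assms transpose_mult_vec
    orthogonal_similarity.PST_imp[OF inverse_similarity] by metis

lemma PGST_iff:
  assumes "x \<in> carrier_vec n" "y \<in> carrier_vec n"
  shows "PGST C x y \<longleftrightarrow> PGST B (M *\<^sub>v x) (M *\<^sub>v y)"
  using PGST_imp assms transpose_mult_vec
    orthogonal_similarity.PGST_imp[OF inverse_similarity] by metis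

lemma sedentary_iff:
  assumes "x \<in> carrier_vec n"
  shows "sedentary K C x \<longleftrightarrow> sedentary K B (M *\<^sub>v x)"
  using sedentary_imp assms transpose_mult_vec
    orthogonal_similarity.sedentary_imp[OF inverse_similarity] by metis

end

section \<open>The symmetric and antisymmetric coordinates\<close>

text \<open>The permutation of positions that \<open>\<phi>\<close> induces on \<open>vertex_order \<phi> vs ss\<close>, where \<open>h\<close> is
  the length of \<open>vs\<close>.\<close>

definition half_swap :: "nat \<Rightarrow> nat \<Rightarrow> nat" where
  "half_swap h i = (if i < h then i + h else if i < 2 * h then i - h else i)"

lemma M_mat_carrier:
  "n = 2 * length vs + length ss \<Longrightarrow> M_mat \<phi> vs ss \<in> carrier_mat n n"
  by (auto simp: M_mat_def vertex_order_def Let_def)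

lemma char_vec_nth:
  assumes "distinct xs" "i < length xs" "j < length xs"
  shows "char_vec xs (xs ! j) $ i = (if i = j then 1 else 0)"
  using assms by (simp add: char_vec_def nth_eq_iff_index_eq)

lemma vertex_order_nth:
  assumes "h = length vs"
  shows "i < h \<Longrightarrow> vertex_order \<phi> vs ss ! i = vs ! i"
    and "i < h \<Longrightarrow> vertex_order \<phi> vs ss ! (i + h) = \<phi> (vs ! i)"
    and "i < length ss \<Longrightarrow> vertex_order \<phi> vs ss ! (i + 2 * h) = ss ! i"
  using assms by (auto simp: vertex_order_def nth_append)

lemma M_mat_index:
  fixes \<phi> vs ss
  defines "h \<equiv> length vs" and "n \<equiv> 2 * length vs + length ss"
  assumes dist: "distinct (vertex_order \<phi> vs ss)" and i: "i < n" and j: "j < n"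
  shows "M_mat \<phi> vs ss $$ (i, j) =
    (if j < h then 1 / sqrt 2 * ((if i = j then 1 else 0) - (if i = j + h then 1 else 0))
     else if j < 2 * h then 1 / sqrt 2 * ((if i = j - h then 1 else 0) + (if i = j then 1 else 0))
     else if i = j then 1 else 0)"
proof -
  define xs where "xs = vertex_order \<phi> vs ss"
  have len: "length xs = n" by (simp add: xs_def vertex_order_def n_def)
  note nth = vertex_order_nth[OF h_def[THEN meta_eq_to_obj_eq], where \<phi> = \<phi> and ss = ss, folded xs_def]
  have cv: "char_vec xs (xs ! k) $ i = (if i = k then 1 else 0)" if "k < n" for k
    using char_vec_nth[OF dist[folded xs_def]] that i len by simp
  have dim: "dim_vec (char_vec xs u) = n" for u by (simp add: char_vec_def len)
  consider "j < h" | "h \<le> j" "j < 2 * h" | "2 * h \<le> j" by linarith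
  then show ?thesis
  proof cases
    case 1
    then have "M_mat \<phi> vs ss $$ (i, j) =
        1 / sqrt 2 * (char_vec xs (vs ! j) $ i - char_vec xs (\<phi> (vs ! j)) $ i)"
      using i j len by (simp add: M_mat_def Let_def xs_def[symmetric] mat_of_cols_index nth_append
        h_def n_def dim)
    then show ?thesis
      using 1 nth(1)[of j] nth(2)[of j] cv[of j] cv[of "j + h"] by (simp add: n_def h_def)
  next
    case 2
    then have "j - h < length vs" by (auto simp: h_def)
    with 2 have "M_mat \<phi> vs ss $$ (i, j) =
        1 / sqrt 2 * (char_vec xs (vs ! (j - h)) $ i + char_vec xs (\<phi> (vs ! (j - h))) $ i)"
      using i j len by (simp add: M_mat_def Let_def xs_def[symmetric] mat_of_cols_index nth_append
        h_def n_def dim)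
    then show ?thesis
      using 2 nth(1)[of "j - h"] nth(2)[of "j - h"] cv[of "j - h"] cv[of j] j
      by (simp add: n_def h_def)
  next
    case 3
    have "j - 2 * h < length ss" "\<not> j - length vs < length vs"
      using 3 j by (auto simp: n_def h_def)
    then have "M_mat \<phi> vs ss $$ (i, j) = char_vec xs (ss ! (j - 2 * h)) $ i"
      using 3 i j len by (simp add: M_mat_def Let_def xs_def[symmetric] mat_of_cols_index nth_append
        h_def n_def dim mult_2 diff_diff_left)
    then show ?thesis
      using 3 nth(3)[of "j - 2 * h"] cv[of j] j by (simp add: n_def h_def)
  qed
qed

text \<open>Rows and columns of \<open>M\<close> have at most two non-zero entries. The next two lemmas are products
  with \<open>M\<close> from the right and from the left; orthogonality and intertwining are read off from
  them.\<close>

lemma sum_M_mat_column: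
  fixes \<phi> vs ss and f :: "nat \<Rightarrow> real"
  defines "h \<equiv> length vs" and "n \<equiv> 2 * length vs + length ss"
  assumes dist: "distinct (vertex_order \<phi> vs ss)" and j: "j < n"
  shows "(\<Sum>k<n. f k * M_mat \<phi> vs ss $$ (k, j)) =
    (if j < h then 1 / sqrt 2 * (f j - f (j + h))
     else if j < 2 * h then 1 / sqrt 2 * (f (j - h) + f j)
     else f j)"
proof -
  have delta: "f k * (if k = a then 1 else 0) = (if k = a then f k else 0)" for k a by simp
  have "(\<Sum>k<n. f k * M_mat \<phi> vs ss $$ (k, j)) = (\<Sum>k<n. f k *
    (if j < h then 1 / sqrt 2 * ((if k = j then 1 else 0) - (if k = j + h then 1 else 0))
     else if j < 2 * h then 1 / sqrt 2 * ((if k = j - h then 1 else 0) + (if k = j then 1 else 0))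
     else if k = j then 1 else 0))"
    using M_mat_index[OF dist] j unfolding h_def n_def by (intro sum.cong) auto
  also have "\<dots> = (if j < h then 1 / sqrt 2 * (f j - f (j + h))
     else if j < 2 * h then 1 / sqrt 2 * (f (j - h) + f j)
     else f j)"
    using j
    by (auto simp: delta h_def n_def mult.left_commute[of _ "1 / sqrt 2"] sum_distrib_left[symmetric]
      right_diff_distrib distrib_left sum.distrib sum_subtractf
      sum_divide_distrib[symmetric] diff_divide_distrib add_divide_distrib)
  finally show ?thesis .
qed

lemma sum_M_mat_row:
  fixes \<phi> vs ss and f :: "nat \<Rightarrow> real"
  defines "h \<equiv> length vs" and "n \<equiv> 2 * length vs + length ss"
  assumes dist: "distinct (vertex_order \<phi> vs ss)" and i: "i < n"
  shows "(\<Sum>k<n. M_mat \<phi> vs ss $$ (i, k) * f k) =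
    (if i < h then 1 / sqrt 2 * (f i + f (i + h))
     else if i < 2 * h then 1 / sqrt 2 * (f i - f (i - h))
     else f i)"
proof -
  have delta: "f k * (if k = a then 1 else 0) = (if k = a then f k else 0)" for k a by simp
  have "(\<Sum>k<n. M_mat \<phi> vs ss $$ (i, k) * f k) = (\<Sum>k<n. f k *
    (if i < h then 1 / sqrt 2 * ((if k = i then 1 else 0) + (if k = i + h then 1 else 0))
     else if i < 2 * h then 1 / sqrt 2 * ((if k = i then 1 else 0) - (if k = i - h then 1 else 0))
     else if k = i then 1 else 0))"
    using M_mat_index[OF dist] i unfolding h_def n_def by (intro sum.cong) auto
  also have "\<dots> = (if i < h then 1 / sqrt 2 * (f i + f (i + h))
     else if i < 2 * h then 1 / sqrt 2 * (f i - f (i - h))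
     else f i)"
    using i
    by (auto simp: delta h_def n_def mult.left_commute[of _ "1 / sqrt 2"] sum_distrib_left[symmetric]
      right_diff_distrib distrib_left sum.distrib sum_subtractf
      sum_divide_distrib[symmetric] diff_divide_distrib add_divide_distrib)
  finally show ?thesis .
qed

lemma M_mat_orthogonal:
  assumes dist: "distinct (vertex_order \<phi> vs ss)" and n: "n = 2 * length vs + length ss"
  shows "transpose_mat (M_mat \<phi> vs ss) * M_mat \<phi> vs ss = 1\<^sub>m n"
proof (rule eq_matI)
  let ?M = "M_mat \<phi> vs ss"
  have M: "?M \<in> carrier_mat n n" by (rule M_mat_carrier[OF n])
  fix i j assume "i < dim_row (1\<^sub>m n :: real mat)" "j < dim_col (1\<^sub>m n :: real mat)"
  then have i: "i < n" and j: "j < n" by auto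
  have "(transpose_mat ?M * ?M) $$ (i, j) = (\<Sum>k<n. ?M $$ (k, i) * ?M $$ (k, j))"
    using M i j by (simp add: scalar_prod_def lessThan_atLeast0)
  also have "\<dots> = 1\<^sub>m n $$ (i, j)"
  proof -
    consider "j < length vs" | "length vs \<le> j" "j < 2 * length vs" | "2 * length vs \<le> j"
      by linarith
    then show ?thesis
      using i j unfolding n sum_M_mat_column[OF dist j[unfolded n]]
      by cases (auto simp: M_mat_index[OF dist] real_div_sqrt)
  qed
  finally show "(transpose_mat ?M * ?M) $$ (i, j) = 1\<^sub>m n $$ (i, j)" .
qed (use M_mat_carrier[OF n] in auto)

lemma N_mat_carrier: "n = 2 * h + s \<Longrightarrow> N_mat h s L \<in> carrier_mat n n"
  by (auto simp: N_mat_def L_minus_def L_plus_tilde_def block_def)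

lemma N_mat_index:
  assumes "i < 2 * h + s" "j < 2 * h + s"
  shows "N_mat h s L $$ (i, j) =
    (if i < h \<and> j < h then L $$ (i, j) - L $$ (i, j + h)
     else if i < h \<or> j < h then 0
     else if i < 2 * h \<and> j < 2 * h then L $$ (i - h, j - h) + L $$ (i - h, j)
     else if i < 2 * h then sqrt 2 * L $$ (i - h, j)
     else if j < 2 * h then sqrt 2 * L $$ (j - h, i)
     else L $$ (i, j))"
  using assms
  by (auto simp: N_mat_def L_minus_def L_plus_tilde_def block_def add.commute mult_2)

text \<open>Invariance under the swap says that \<open>L\<close> has the block form with the blocks
  \<open>L'\<close>, \<open>A\<^sub>\<phi>\<close>, \<open>A\<^sub>S\<close> repeated. On
  antisymmetric vectors the two copies of \<open>A\<^sub>S\<close> cancel and \<open>A\<^sub>\<phi>\<close> acts with a minus sign; on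
  symmetric ones they add, and \<open>2 / sqrt 2 = sqrt 2\<close> gives the weight of \<open>A\<^sub>S\<close> in the second
  block of \<open>N\<close>.\<close>

lemma M_mat_intertwines:
  fixes L :: "real mat" and \<phi> vs ss
  defines "h \<equiv> length vs" and "n \<equiv> 2 * length vs + length ss"
  assumes dist: "distinct (vertex_order \<phi> vs ss)"
    and L: "L \<in> carrier_mat n n"
    and sym: "\<And>i j. i < n \<Longrightarrow> j < n \<Longrightarrow> L $$ (j, i) = L $$ (i, j)"
    and swap: "\<And>i j. i < n \<Longrightarrow> j < n \<Longrightarrow> L $$ (half_swap h i, half_swap h j) = L $$ (i, j)"
  shows "L * M_mat \<phi> vs ss = M_mat \<phi> vs ss * N_mat h (length ss) L"
proof (rule eq_matI)
  let ?M = "M_mat \<phi> vs ss" and ?N = "N_mat h (length ss) L"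
  have M: "?M \<in> carrier_mat n n" by (rule M_mat_carrier) (simp add: n_def)
  have N: "?N \<in> carrier_mat n n" by (rule N_mat_carrier) (simp add: n_def h_def)
  have hn: "n = 2 * h + length ss" by (simp add: n_def h_def)
  fix i j assume "i < dim_row (?M * ?N)" "j < dim_col (?M * ?N)"
  then have i: "i < n" and j: "j < n" using M N by auto
  have r: "1 / sqrt 2 * (sqrt 2 * x) = x" "sqrt 2 * (1 / sqrt 2 * x) = x" for x :: real by auto
  have two: "2 * x / sqrt 2 = sqrt 2 * x" for x :: real by (simp add: field_simps)
  note Nij = N_mat_index[of _ h "length ss" _ L, folded hn]
  have "(L * ?M) $$ (i, j) = (\<Sum>k<n. L $$ (i, k) * ?M $$ (k, j))"
    using L M i j by (simp add: scalar_prod_def lessThan_atLeast0)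
  also have "\<dots> = (if j < h then 1 / sqrt 2 * (L $$ (i, j) - L $$ (i, j + h))
     else if j < 2 * h then 1 / sqrt 2 * (L $$ (i, j - h) + L $$ (i, j))
     else L $$ (i, j))"
    using sum_M_mat_column[OF dist, of j "\<lambda>k. L $$ (i, k)"] j unfolding n_def h_def by simp
  also have "\<dots> = (if i < h then 1 / sqrt 2 * (?N $$ (i, j) + ?N $$ (i + h, j))
     else if i < 2 * h then 1 / sqrt 2 * (?N $$ (i, j) - ?N $$ (i - h, j))
     else ?N $$ (i, j))" (is "?l = ?r")
  proof -
    consider "i < h" | "h \<le> i" "i < 2 * h" | "2 * h \<le> i" by linarith
    then show ?thesis
    proof cases
      case 1
      then have "i + h < n" using hn by simp
      then show ?thesis using 1 i j by (simp add: Nij r)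
    next
      case 2
      \<comment> \<open>\<open>N\<close> is built from the rows of \<open>L\<close> that belong to the half graph, so the mirrored rows
        have to be moved there by the swap.\<close>
      have "half_swap h i = i - h" "h \<le> j \<Longrightarrow> j < 2 * h \<Longrightarrow> half_swap h (j - h) = j"
        "j < h \<Longrightarrow> half_swap h (j + h) = j"
        using 2 by (auto simp: half_swap_def)
      then have "L $$ (i, j) = L $$ (i - h, half_swap h j)"
        "j < h \<Longrightarrow> L $$ (i, j + h) = L $$ (i - h, j)"
        "h \<le> j \<Longrightarrow> j < 2 * h \<Longrightarrow> L $$ (i, j - h) = L $$ (i - h, j)"
        using 2 i j hn swap[OF i j] swap[OF i, of "j + h"] swap[OF i, of "j - h"]
        by auto
      then show ?thesis using 2 i j by (auto simp: Nij r half_swap_def add_divide_distrib diff_divide_distrib add.commute)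
    next
      case 3
      have "j < h \<Longrightarrow> L $$ (i, j + h) = L $$ (i, j)"
        "h \<le> j \<Longrightarrow> j < 2 * h \<Longrightarrow> L $$ (i, j - h) = L $$ (i, j) \<and> L $$ (j - h, i) = L $$ (i, j)"
        using 3 i j hn swap[OF i j] sym[OF i, of "j - h"]
        by (auto simp: half_swap_def)
      then show ?thesis using 3 i j by (auto simp: Nij two)
    qed
  qed
  also have "\<dots> = (\<Sum>k<n. ?M $$ (i, k) * ?N $$ (k, j))"
    using sum_M_mat_row[OF dist, of i "\<lambda>k. ?N $$ (k, j)"] i unfolding n_def h_def by simp
  also have "\<dots> = (?M * ?N) $$ (i, j)"
    using M N i j by (simp add: scalar_prod_def lessThan_atLeast0)
  finally show "(L * ?M) $$ (i, j) = (?M * ?N) $$ (i, j)" .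
qed (use L M_mat_carrier[of n vs ss \<phi>] N_mat_carrier[of n h "length ss" L] in \<open>auto simp: n_def h_def\<close>)


section \<open>Symmetry of the q-Laplacian under the involution\<close>

lemma vertex_order_half_swap:
  assumes inv: "\<And>v. v \<in> set vs \<Longrightarrow> \<phi> (\<phi> v) = v" and fixed: "\<And>v. v \<in> set ss \<Longrightarrow> \<phi> v = v"
    and i: "i < 2 * length vs + length ss"
  shows "vertex_order \<phi> vs ss ! half_swap (length vs) i = \<phi> (vertex_order \<phi> vs ss ! i)"
  using i inv fixed by (auto simp: vertex_order_def half_swap_def nth_append)

lemma adj_commute: "adj E wt v u = adj E wt u v"
  by (simp add: adj_def insert_commute)

lemma adj_automorphism:
  assumes "automorphism V E wt \<phi>" "u \<in> V" "v \<in> V"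
  shows "adj E wt (\<phi> u) (\<phi> v) = adj E wt u v"
  using assms by (simp add: adj_def automorphism_def)

lemma qlaplacian_carrier: "qlaplacian E wt \<eta> q xs \<in> carrier_mat (length xs) (length xs)"
  by (auto simp: qlaplacian_def adj_mat_def deg_mat_def potential_mat_def)

lemma qlaplacian_index:
  assumes "distinct xs" "i < length xs" "j < length xs"
  shows "qlaplacian E wt \<eta> q xs $$ (i, j) =
    (if i = j then 1 - q\<^sup>2 + q\<^sup>2 * ((\<Sum>w\<in>set xs. adj E wt (xs ! i) w) + \<eta> (xs ! i)) else 0)
    - q * adj E wt (xs ! i) (xs ! j)"
proof -
  have "(\<Sum>w\<in>set xs. adj E wt u w) = (\<Sum>k<length xs. adj E wt u (xs ! k))" for u
    using sum.reindex_bij_betw[OF bij_betw_nth[OF assms(1) refl refl]] by metis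
  then show ?thesis using assms
    by (simp add: qlaplacian_def adj_mat_def deg_mat_def potential_mat_def mat_diag_def)
qed

text \<open>The only entry that is not local is the degree. It is invariant because the sum over all
  vertices may be reindexed by \<open>\<phi>\<close>.\<close>

lemma qlaplacian_half_swap:
  assumes aut: "automorphism V E wt \<phi>" and \<eta>: "\<And>v. v \<in> V \<Longrightarrow> \<eta> (\<phi> v) = \<eta> v"
    and inv: "\<And>v. v \<in> V \<Longrightarrow> \<phi> (\<phi> v) = v" and fixed: "\<And>v. v \<in> set ss \<Longrightarrow> \<phi> v = v"
    and xs: "xs = vertex_order \<phi> vs ss" "distinct xs" "set xs = V"
    and i: "i < length xs" and j: "j < length xs"
  shows "qlaplacian E wt \<eta> q xs $$ (half_swap (length vs) i, half_swap (length vs) j) =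
    qlaplacian E wt \<eta> q xs $$ (i, j)"
proof -
  have len: "length xs = 2 * length vs + length ss" by (simp add: xs(1) vertex_order_def)
  have V: "set vs \<subseteq> V" using xs by (auto simp: vertex_order_def)
  have lt: "half_swap (length vs) k < length xs" if "k < length xs" for k
    using that len by (auto simp: half_swap_def)
  have nth: "xs ! half_swap (length vs) k = \<phi> (xs ! k)" if "k < length xs" for k
    using vertex_order_half_swap[of vs \<phi> ss k] inv fixed V that len by (auto simp: xs(1))
  have inj: "half_swap (length vs) i = half_swap (length vs) j \<longleftrightarrow> i = j"
    by (auto simp: half_swap_def)
  have mem: "xs ! k \<in> V" if "k < length xs" for k using xs(3) that by auto
  have "(\<Sum>w\<in>V. adj E wt (\<phi> u) w) = (\<Sum>w\<in>V. adj E wt u w)" if u: "u \<in> V" for u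
  proof -
    have "bij_betw \<phi> V V" using aut by (simp add: automorphism_def)
    then have "(\<Sum>w\<in>V. adj E wt (\<phi> u) w) = (\<Sum>w\<in>V. adj E wt (\<phi> u) (\<phi> w))"
      by (rule sum.reindex_bij_betw[symmetric])
    also have "\<dots> = (\<Sum>w\<in>V. adj E wt u w)"
      by (intro sum.cong refl adj_automorphism[OF aut u])
    finally show ?thesis .
  qed
  then show ?thesis
    using i j lt nth inj mem \<eta> adj_automorphism[OF aut]
    by (simp add: qlaplacian_index[OF xs(2)] xs(3))
qed

text \<open>One vertex from each two-element orbit, its mirror image and the fixed points together exhaust
  the vertices without repetition, so the listing is a legitimate order of rows and columns.\<close>

lemma half_graph_vertex_order:
  assumes inv: "\<And>v. v \<in> V \<Longrightarrow> \<phi> v \<in> V \<and> \<phi> (\<phi> v) = v"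
    and half: "half_graph_vertices V \<phi> (set vs)" and vs: "distinct vs"
    and ss: "distinct ss" "set ss = fixed_vertices V \<phi>"
  shows "distinct (vertex_order \<phi> vs ss)" and "set (vertex_order \<phi> vs ss) = V"
proof -
  have H: "v \<in> V" "\<phi> v \<noteq> v" if "v \<in> set vs" for v
    using half that by (auto simp: half_graph_vertices_def fixed_vertices_def)
  have S: "v \<in> set ss \<longleftrightarrow> v \<in> V \<and> \<phi> v = v" for v
    by (simp add: ss(2) fixed_vertices_def)
  have choice: "v \<in> set vs \<longleftrightarrow> \<phi> v \<notin> set vs" if "v \<in> V" "\<phi> v \<noteq> v" for v
  proof -
    have "\<exists>!u. u \<in> {v, \<phi> v} \<and> u \<in> set vs"
      using half that by (auto simp: half_graph_vertices_def fixed_vertices_def)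
    then show ?thesis using that by auto
  qed
  have "inj_on \<phi> (set vs)" by (rule inj_onI) (metis H(1) inv)
  moreover have "set vs \<inter> \<phi> ` set vs = {}" using choice H by blast
  moreover have "v \<notin> set ss" "\<phi> v \<notin> set ss" if "v \<in> set vs" for v
    using H[OF that] inv[of v] S by auto
  ultimately show "distinct (vertex_order \<phi> vs ss)"
    using vs ss(1) by (auto simp: vertex_order_def distinct_map)
  show "set (vertex_order \<phi> vs ss) = V"
  proof (intro equalityI subsetI)
    fix v assume v: "v \<in> V"
    then have "v \<in> set ss \<or> v \<in> set vs \<or> \<phi> v \<in> set vs" using choice S by blast
    moreover have "v = \<phi> (\<phi> v)" using inv[OF v] by simp
    ultimately show "v \<in> set (vertex_order \<phi> vs ss)" by (auto simp: vertex_order_def)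
  qed (use H S inv in \<open>auto simp: vertex_order_def\<close>)
qed

theorem corollary1:
  fixes V :: "'a set" and E :: "'a set set" and wt :: "'a set \<Rightarrow> real"
    and \<phi> :: "'a \<Rightarrow> 'a" and \<eta> :: "'a \<Rightarrow> real" and q :: real
    and vs ss :: "'a list" and L N M :: "real mat"
  assumes "weighted_graph V E wt"
    and "involution V E wt \<phi>"
    and "\<forall>v\<in>V. \<eta> v = \<eta> (\<phi> v)"
    and "q \<noteq> 0"
    and "distinct vs" and "half_graph_vertices V \<phi> (set vs)"
    and "distinct ss" and "set ss = fixed_vertices V \<phi>"
    and "L = qlaplacian E wt \<eta> q (vertex_order \<phi> vs ss)"
    and "N = N_mat (length vs) (length ss) L"
    and "M = M_mat \<phi> vs ss"
  shows "(\<forall>x y. is_state (card V) x \<longrightarrow> is_state (card V) y \<longrightarrow>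
            (strongly_cospectral N x y \<longleftrightarrow> strongly_cospectral L (M *\<^sub>v x) (M *\<^sub>v y)) \<and>
            (PST N x y \<longleftrightarrow> PST L (M *\<^sub>v x) (M *\<^sub>v y)) \<and>
            (PGST N x y \<longleftrightarrow> PGST L (M *\<^sub>v x) (M *\<^sub>v y))) \<and>
         (\<forall>x. is_state (card V) x \<longrightarrow>
            (periodic N x \<longleftrightarrow> periodic L (M *\<^sub>v x)) \<and>
            (\<forall>C. 0 < C \<longrightarrow> C \<le> 1 \<longrightarrow> (sedentary C N x \<longleftrightarrow> sedentary C L (M *\<^sub>v x))))"
proof -
  define xs where "xs = vertex_order \<phi> vs ss"
  have aut: "automorphism V E wt \<phi>" using assms(2) by (simp add: involution_def)
  have inv: "\<phi> v \<in> V \<and> \<phi> (\<phi> v) = v" if "v \<in> V" for v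
    using assms(2) that by (auto simp: involution_def automorphism_def bij_betw_def)
  have dist: "distinct xs" and set: "set xs = V"
    unfolding xs_def using half_graph_vertex_order[OF inv assms(6,5,7,8)] by auto
  have len: "length xs = 2 * length vs + length ss" by (simp add: xs_def vertex_order_def)
  have card: "card V = 2 * length vs + length ss" using distinct_card[OF dist] set len by simp
  have fixed: "\<phi> v = v" if "v \<in> set ss" for v
    using that assms(8) by (simp add: fixed_vertices_def)
  have \<eta>: "\<eta> (\<phi> v) = \<eta> v" if "v \<in> V" for v
    using assms(3) that by metis
  have L: "L = qlaplacian E wt \<eta> q xs" by (simp add: assms(9) xs_def)
  interpret orthogonal_similarity "card V" M L N
  proof
    show "M \<in> carrier_mat (card V) (card V)" unfolding assms(11) by (rule M_mat_carrier[OF card])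
    show "L \<in> carrier_mat (card V) (card V)"
      using qlaplacian_carrier[of E wt \<eta> q xs] by (simp add: L card len)
    then have Lc: "L \<in> carrier_mat (2 * length vs + length ss) (2 * length vs + length ss)"
      by (simp add: card)
    show "N \<in> carrier_mat (card V) (card V)" unfolding assms(10) by (rule N_mat_carrier[OF card])
    show "transpose_mat M * M = 1\<^sub>m (card V)"
      unfolding assms(11) by (rule M_mat_orthogonal[OF dist[unfolded xs_def] card])
    show "L * M = M * N" unfolding assms(10,11)
    proof (rule M_mat_intertwines[OF dist[unfolded xs_def] Lc])
      fix i j assume ij: "i < 2 * length vs + length ss" "j < 2 * length vs + length ss"
      show "L $$ (j, i) = L $$ (i, j)"
        using ij by (simp add: L qlaplacian_index[OF dist] len adj_commute)
      show "L $$ (half_swap (length vs) i, half_swap (length vs) j) = L $$ (i, j)"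
        unfolding L
        by (rule qlaplacian_half_swap[where \<eta> = \<eta> and \<phi> = \<phi>, OF aut \<eta> _ fixed xs_def dist set])
          (use ij len inv in auto)
    qed
  qed
  show ?thesis
    using strongly_cospectral_iff PST_iff PGST_iff sedentary_iff
    by (auto simp: is_state_def periodic_def)
qed

end
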